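(* Let $n$ be a positive integer. For $v\in Z_4^n$ and $i=0,1,2,3$, let $f_i$ be the number of entries of $v$ equal to $i$. Let $D$ be the two-level $2^{2n}\times(2n+2)$ design generated by $G=(v,I_n)$, where either $f_1+f_3=n-1$ and $f_2=1$, or $f_1+f_3=n$ and $f_2=0$. Then any half-fraction of $D$ has maximum projectivity $2n-2$ among all $2^{2n-1}\times(2n+1)$ designs that are half-fractions of designs generated by $(w,I_n)$, $w\in Z_4^n$.
   Context: $Z_4=\{0,1,2,3\}$ is the ring of integers modulo 4, and $I_n$ is the $n\times n$ identity matrix. Design generated by $G=(v,I_n)$: let $C$ be the $2^{2n}\times(n+1)$ matrix whose rows are all linear combinations $uG$, $u\in Z_4^n$. Replace each entry of $C$ by a pair of $\pm1$ symbols via the Gray map $0\mapsto(1,1)$, $1\mapsto(1,-1)$, $2\mapsto(-1,-1)$, $3\mapsto(-1,1)$, so that column $j$ of $C$ becomes columns $2j-1,2j$. The result is a $2^{2n}\times(2n+2)$ matrix with entries $\pm1$ (a two-level design; rows are runs, columns are factors). Half-fraction: choose any column of the design (the branching column), which divides the design into two half-fractions according to the symbols of that column: keep only the runs in which the branching column takes one fixed symbol ($+1$ or $-1$), and delete the branching column; this yields a $2^{2n-1}\times(2n+1)$ design. A two-level design has projectivity $p$ if for every set of $p$ columns, the projection of the design onto these columns contains all $2^p$ level combinations in $\{\pm1\}^p$ (possibly with repetitions). "The projectivity" of a design is the largest such $p$ (it is $0$ if some column is constant). "Has maximum projectivity $x$ among a class" means the projectivity is $x$ and no design in the class has projectivity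 larger than $x$.
   Formalization: The formal theorem assumes n ≥ 2. For n = 1 the claim is false for every admissible v: the design generated by (2, I_1), branched on its third column, has the 2×3 half-fraction {(1,1,1), (−1,−1,−1)} of projectivity 1 > 0 = 2n−2. *)

theory Defs
  imports "Jordan_Normal_Form.Matrix" "HOL-Library.Numeral_Type" "HOL-Library.Multiset"
begin

text \<open>
  The type \<open>4\<close> is the ring of integers modulo 4.  A two-level design is the multiset of its runs,
  each run being the list of its levels \<open>1\<close>, \<open>-1\<close>; factors are numbered from \<open>0\<close>.  The order of
  the runs is immaterial, but repeated runs are kept.
\<close>

type_synonym design = "int list multiset"

definition two_level_design :: "nat \<Rightarrow> nat \<Rightarrow> design \<Rightarrow> bool" where
  "two_level_design N k D \<longleftrightarrow>
     size D = N \<and> (\<forall>r \<in># D. length r = k \<and> set r \<subseteq> {1, -1})"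

definition freq :: "4 \<Rightarrow> 4 vec \<Rightarrow> nat" where
  "freq a v = card {i. i < dim_vec v \<and> v $ i = a}"

definition generator :: "4 vec \<Rightarrow> 4 mat" where
  "generator v = mat (dim_vec v) (dim_vec v + 1)
     (\<lambda>(i, j). if j = 0 then v $ i else 1\<^sub>m (dim_vec v) $$ (i, j - 1))"

definition gray :: "4 \<Rightarrow> int list" where
  "gray x = (if x = 0 then [1, 1] else if x = 1 then [1, -1]
             else if x = 2 then [-1, -1] else [-1, 1])"

lemma finite_carrier_vec_4: "finite (carrier_vec n :: 4 vec set)"
proof (rule finite_subset)
  show "carrier_vec n \<subseteq> vec_of_list ` {xs :: 4 list. set xs \<subseteq> UNIV \<and> length xs = n}"
  proof
    fix u :: "4 vec"
    assume "u \<in> carrier_vec n"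
    then have "length (list_of_vec u) = n"
      by (metis carrier_vecD Matrix.length_list_of_vec)
    moreover have "u = vec_of_list (list_of_vec u)"
      by (metis vec_list)
    ultimately show "u \<in> vec_of_list ` {xs. set xs \<subseteq> UNIV \<and> length xs = n}"
      by (intro image_eqI CollectI conjI subset_UNIV)
  qed
  show "finite (vec_of_list ` {xs :: 4 list. set xs \<subseteq> UNIV \<and> length xs = n})"
    by (intro finite_imageI finite_lists_length_eq finite)
qed

text \<open>The row vector \<open>u G\<close> is written as \<open>G\<^sup>T u\<close>.\<close>

definition generated_design :: "4 mat \<Rightarrow> design" where
  "generated_design G =
     image_mset (\<lambda>u. concat (map gray (list_of_vec (transpose_mat G *\<^sub>v u))))
       (mset_set (carrier_vec (dim_row G)))"

definition half_fraction :: "nat \<Rightarrow> int \<Rightarrow> design \<Rightarrow> design" where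
  "half_fraction j s D =
     image_mset (\<lambda>r. take j r @ drop (Suc j) r) {# r \<in># D. r ! j = s #}"

definition half_fractions :: "nat \<Rightarrow> design \<Rightarrow> design set" where
  "half_fractions k D = {half_fraction j s D |j s. j < k \<and> s \<in> {1, -1}}"

definition has_projectivity :: "nat \<Rightarrow> design \<Rightarrow> nat \<Rightarrow> bool" where
  "has_projectivity k D p \<longleftrightarrow> p \<le> k \<and>
     (\<forall>S \<subseteq> {..<k}. card S = p \<longrightarrow>
       (\<forall>e. (\<forall>j \<in> S. e j \<in> {1, -1}) \<longrightarrow> (\<exists>r \<in># D. \<forall>j \<in> S. r ! j = e j)))"

text \<open>
  The parameter \<open>k\<close> is the number of factors.  The set below is finite, and it contains \<open>0\<close> as soon
  as the design has a run; for a design without runs the value is unspecified.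
\<close>

definition projectivity :: "nat \<Rightarrow> design \<Rightarrow> nat" where
  "projectivity k D = Max {p. has_projectivity k D p}"

definition has_max_projectivity_among :: "nat \<Rightarrow> design \<Rightarrow> nat \<Rightarrow> design set \<Rightarrow> bool" where
  "has_max_projectivity_among k D x \<C> \<longleftrightarrow>
     D \<in> \<C> \<and> projectivity k D = x \<and> (\<forall>E \<in> \<C>. projectivity k E \<le> x)"

text \<open>
  The size condition matters when \<open>w = 0\<close>: the first two factors are then constant, and branching
  on them keeps all runs or none.
\<close>

definition half_fraction_class :: "nat \<Rightarrow> design set" where
  "half_fraction_class n =
     {E. two_level_design (2 ^ (2 * n - 1)) (2 * n + 1) E \<and>
         (\<exists>w \<in> carrier_vec n. E \<in> half_fractions (2 * n + 2) (generated_design (generator w)))}"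

end

theory Submission
  imports Defs
begin

text \<open>
  A half-fraction has \<open>2\<^sup>t\<close> runs and \<open>t + 2\<close> factors with \<open>t = 2n - 1\<close>. If it had projectivity \<open>t\<close>,
  runs agreeing on \<open>t\<close> factors would coincide, so distinct runs would differ in at least three
  factors. Changing either of the first two levels of a run, with the other \<open>t - 1\<close> leading levels
  kept, then changes both of the last two levels; the two new runs differ in only two factors, a
  contradiction.

  Conversely, the rows generated by \<open>(v, I\<^sub>n)\<close> are the solutions \<open>c\<close> of the single parity check
  \<open>-c\<^sub>0 + \<Sum>\<^sub>i v\<^sub>i c\<^sub>i\<^sub>+\<^sub>1 = 0\<close>, none of whose coefficients is \<open>0\<close> and at most one of which is \<open>2\<close>. With all
  but three levels prescribed, an entry with one unprescribed level still ranges over two consecutive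
  residues and one with two unprescribed levels over \<open>Z\<^sub>4\<close>, which always leaves enough freedom to
  solve the check. Hence \<open>D\<close> has projectivity \<open>2n - 1\<close>, and its half-fractions have \<open>2n - 2\<close>.
\<close>

section \<open>Projectivity\<close>

lemma has_projectivityD:
  assumes "has_projectivity k D p" and "S \<subseteq> {..<k}" "card S = p" and "\<forall>j\<in>S. e j \<in> {1, -1}"
  shows "\<exists>r\<in>#D. \<forall>j\<in>S. r ! j = e j"
  using assms unfolding has_projectivity_def by blast

lemma has_projectivity_mono:
  assumes "has_projectivity k D p" and "q \<le> p"
  shows "has_projectivity k D q"
  unfolding has_projectivity_def
proof (intro conjI allI impI)
  show "q \<le> k"
    using assms by (simp add: has_projectivity_def)
next
  fix S and e :: "nat \<Rightarrow> int"
  assume S: "S \<subseteq> {..<k}" "card S = q" and e: "\<forall>j\<in>S. e j \<in> {1, -1}"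
  have "p \<le> k"
    using assms(1) by (simp add: has_projectivity_def)
  then obtain S' where S': "S \<subseteq> S'" "S' \<subseteq> {..<k}" "card S' = p"
    using exists_subset_between[of S p "{..<k}"] S assms(2) by auto
  \<comment> \<open>Levels on the added factors are arbitrary; 1 serves as the default.\<close>
  let ?e = "\<lambda>j. if j \<in> S then e j else 1"
  have "\<forall>j\<in>S'. ?e j \<in> {1, -1}"
    using e by auto
  then have "\<exists>r\<in>#D. \<forall>j\<in>S'. r ! j = ?e j"
    by (rule has_projectivityD[OF assms(1) S'(2,3)])
  then obtain r where r: "r \<in># D" "\<forall>j\<in>S'. r ! j = ?e j" ..
  have "r ! j = e j" if "j \<in> S" for j
    using r(2) S'(1) that by auto
  then show "\<exists>r\<in>#D. \<forall>j\<in>S. r ! j = e j"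
    using r(1) by blast
qed

lemma finite_has_projectivity: "finite {p. has_projectivity k D p}"
  by (rule finite_subset[of _ "{..k}"]) (auto simp: has_projectivity_def)

text \<open>By monotonicity, failure at \<open>Suc p\<close> excludes every larger value. A run is
  required so that the set under \<open>Max\<close> contains 0.\<close>

lemma projectivity_le:
  assumes "D \<noteq> {#}" and "\<not> has_projectivity k D (Suc p)"
  shows "projectivity k D \<le> p"
  unfolding projectivity_def
proof (rule Max.boundedI)
  have "has_projectivity k D 0"
    unfolding has_projectivity_def
  proof (intro conjI allI impI)
    fix S and e :: "nat \<Rightarrow> int"
    assume "S \<subseteq> {..<k}" "card S = 0"
    then have "S = {}"
      using finite_subset by fastforce
    then show "\<exists>r\<in>#D. \<forall>j\<in>S. r ! j = e j"
      using assms(1) by auto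
  qed simp
  then show "{p. has_projectivity k D p} \<noteq> {}"
    by blast
  show "q \<le> p" if "q \<in> {p. has_projectivity k D p}" for q
    using that assms(2) has_projectivity_mono[of k D q "Suc p"] not_less_eq_eq by blast
qed (rule finite_has_projectivity)

lemma projectivity_ge: "has_projectivity k D p \<Longrightarrow> p \<le> projectivity k D"
  unfolding projectivity_def by (rule Max_ge) (auto simp: finite_has_projectivity)

text \<open>Pigeonhole: the at most \<open>2 ^ t\<close> distinct runs project onto all
  \<open>2 ^ t\<close> level combinations on \<open>S\<close>, so the projection is injective on
  them.\<close>

lemma run_eqI_of_projectivity:
  assumes D: "two_level_design (2 ^ t) k D" and p: "has_projectivity k D t"
    and S: "S \<subseteq> {..<k}" "card S = t"
    and r: "r \<in># D" "r' \<in># D" "\<forall>j\<in>S. r ! j = r' ! j"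
  shows "r = r'"
proof -
  let ?f = "\<lambda>r. restrict (\<lambda>j. r ! j) S"
  have fin: "finite S"
    using S(1) finite_subset by blast
  have sub: "(\<Pi>\<^sub>E j\<in>S. {1, -1}) \<subseteq> ?f ` set_mset D"
  proof
    fix e :: "nat \<Rightarrow> int"
    assume e: "e \<in> (\<Pi>\<^sub>E j\<in>S. {1, -1})"
    then have "\<forall>j\<in>S. e j \<in> {1, -1}"
      by auto
    then obtain r where "r \<in># D" "\<forall>j\<in>S. r ! j = e j"
      using has_projectivityD[OF p S] by blast
    moreover from this have "e = ?f r"
      using e by (auto simp: PiE_def extensional_def restrict_def)
    ultimately show "e \<in> ?f ` set_mset D"
      by blast
  qed
  have "2 ^ t = card (\<Pi>\<^sub>E j\<in>S. {1, -1::int})"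
    using S(2) by (simp add: card_PiE[OF fin] numeral_2_eq_2)
  also have "\<dots> \<le> card (?f ` set_mset D)"
    by (rule card_mono[OF _ sub]) simp
  finally have ge: "2 ^ t \<le> card (?f ` set_mset D)" .
  have "card (set_mset D) \<le> size D"
    using size_mset_mono[OF mset_set_set_mset_msubset[of D]] by simp
  moreover have "card (?f ` set_mset D) \<le> card (set_mset D)"
    by (rule card_image_le) simp
  ultimately have "card (?f ` set_mset D) = card (set_mset D)"
    using ge D by (simp add: two_level_design_def)
  then have "inj_on ?f (set_mset D)"
    by (intro eq_card_imp_inj_on) auto
  moreover have "?f r = ?f r'"
    using r(3) by auto
  ultimately show ?thesis
    using r(1,2) by (auto dest: inj_onD)
qed

text \<open>The runs would form a binary code of length \<open>t + 2\<close> with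
  \<open>2 ^ t\<close> words and minimum distance at least 3, a nontrivial binary MDS code.\<close>

lemma index_unity_not_has_projectivity:
  assumes D: "two_level_design (2 ^ t) (t + 2) D" and "t \<ge> 2"
  shows "\<not> has_projectivity (t + 2) D t"
proof
  assume p: "has_projectivity (t + 2) D t"
  note eqI = run_eqI_of_projectivity[OF D p]
  have lev: "r ! j \<in> {1, -1}" if "r \<in># D" "j < t + 2" for r j
    using D that unfolding two_level_design_def by (metis nth_mem subsetD)
  have "D \<noteq> {#}"
    using D by (auto simp: two_level_design_def)
  then obtain r0 where r0: "r0 \<in># D"
    by blast
  have ex: "\<exists>r\<in>#D. \<forall>j<t. r ! j = (if j = i then - r0 ! j else r0 ! j)" for i
  proof -
    have "\<forall>j\<in>{..<t}. (if j = i then - r0 ! j else r0 ! j) \<in> {1, -1}"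
    proof
      fix j
      assume "j \<in> {..<t}"
      then show "(if j = i then - r0 ! j else r0 ! j) \<in> {1, -1}"
        using lev[OF r0, of j] by auto
    qed
    moreover have "{..<t} \<subseteq> {..<t + 2}"
      by auto
    ultimately have "\<exists>r\<in>#D. \<forall>j\<in>{..<t}. r ! j = (if j = i then - r0 ! j else r0 ! j)"
      by (intro has_projectivityD[OF p]) auto
    then show ?thesis
      by (simp only: lessThan_iff Ball_def)
  qed
  have last: "r ! l = - r0 ! l"
    if r: "r \<in># D" "\<forall>j<t. r ! j = (if j = i then - r0 ! j else r0 ! j)"
      and i: "i < t" and l: "l \<in> {t, t + 1}" for r i l
  proof (rule ccontr)
    assume neq: "r ! l \<noteq> - r0 ! l"
    have "l < t + 2"
      using l by auto
    then have "r ! l = r0 ! l"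
      using neq lev[OF r0, of l] lev[OF r(1), of l] by auto
    \<comment> \<open>Trading factor \<open>i\<close> for \<open>l\<close> gives \<open>t\<close>
      factors on which \<open>r\<close> and \<open>r0\<close> agree.\<close>
    then have "\<forall>j \<in> insert l ({..<t} - {i}). r ! j = r0 ! j"
      using r(2) by simp
    moreover have "card (insert l ({..<t} - {i})) = t"
      using i l by auto
    moreover have "insert l ({..<t} - {i}) \<subseteq> {..<t + 2}"
      using l by auto
    ultimately have "r = r0"
      using eqI[of "insert l ({..<t} - {i})" r r0] r(1) r0 by blast
    then show False
      using spec[OF r(2), of i] i lev[OF r0, of i] by auto
  qed
  obtain r1 where r1: "r1 \<in># D" "\<forall>j<t. r1 ! j = (if j = 0 then - r0 ! j else r0 ! j)"
    using ex by blast
  obtain r2 where r2: "r2 \<in># D" "\<forall>j<t. r2 ! j = (if j = 1 then - r0 ! j else r0 ! j)"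
    using ex by blast
  \<comment> \<open>Beyond factors 0 and 1, both runs copy \<open>r0\<close> on the leading factors
    and negate it on the last two.\<close>
  have "r1 ! j = r2 ! j" if "j \<in> {2..<t + 2}" for j
  proof (cases "j < t")
    case True
    then show ?thesis
      using r1(2) r2(2) that by simp
  next
    case False
    then have "j \<in> {t, t + 1}"
      using that by auto
    then show ?thesis
      using last[OF r1 _ \<open>j \<in> {t, t + 1}\<close>] last[OF r2 _ \<open>j \<in> {t, t + 1}\<close>] \<open>t \<ge> 2\<close> by linarith
  qed
  then have "r1 = r2"
    by (intro eqI[of "{2..<t + 2}"] r1(1) r2(1)) auto
  then have "r0 ! 0 = - r0 ! 0"
    using spec[OF r1(2), of 0] spec[OF r2(2), of 0] \<open>t \<ge> 2\<close> by simp
  then show False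
    using lev[OF r0, of 0] by auto
qed

text \<open>Prescribing \<open>p\<close> levels in the half-fraction together with the branching
  level prescribes \<open>p + 1\<close> levels in \<open>D\<close>.\<close>

lemma has_projectivity_half_fraction:
  assumes p: "has_projectivity (Suc k) D (Suc p)" and D: "two_level_design N (Suc k) D"
    and j: "j < Suc k" and s: "s \<in> {1, -1}"
  shows "has_projectivity k (half_fraction j s D) p"
  unfolding has_projectivity_def
proof (intro conjI allI impI)
  show "p \<le> k"
    using p by (simp add: has_projectivity_def)
next
  fix S and e :: "nat \<Rightarrow> int"
  assume S: "S \<subseteq> {..<k}" "card S = p" and e: "\<forall>i\<in>S. e i \<in> {1, -1}"
  \<comment> \<open>\<open>skip\<close> sends a factor of the half-fraction to its number in
    \<open>D\<close>; \<open>?e\<close> transports \<open>e\<close> along it and adds the branching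
    level.\<close>
  define skip where "skip i = (if i < j then i else Suc i)" for i
  let ?e = "\<lambda>i. if i = j then s else if i < j then e i else e (i - 1)"
  have e_skip: "?e (skip i) = e i" for i
    by (auto simp: skip_def)
  have fin: "finite S"
    using S(1) finite_subset by blast
  have "inj_on skip S" and nin: "j \<notin> skip ` S"
    by (auto simp: inj_on_def skip_def split: if_splits)
  then have "card (insert j (skip ` S)) = Suc p"
    using S(2) fin by (simp add: card_image)
  moreover have "insert j (skip ` S) \<subseteq> {..<Suc k}"
    using S(1) j by (auto simp: skip_def)
  moreover have "\<forall>i\<in>insert j (skip ` S). ?e i \<in> {1, -1}"
  proof
    fix i
    assume "i \<in> insert j (skip ` S)"
    then consider "i = j" | i' where "i' \<in> S" "i = skip i'"
      by blast
    then show "?e i \<in> {1, -1}"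
    proof cases
      case 1
      then show ?thesis
        using s by simp
    next
      case 2
      then show ?thesis
        using e by (simp only: e_skip)
    qed
  qed
  ultimately have "\<exists>r\<in>#D. \<forall>i\<in>insert j (skip ` S). r ! i = ?e i"
    by (intro has_projectivityD[OF p])
  then obtain r where r: "r \<in># D" "\<forall>i\<in>insert j (skip ` S). r ! i = ?e i" ..
  have len: "length r = Suc k"
    using D r(1) by (auto simp: two_level_design_def)
  have "(take j r @ drop (Suc j) r) ! i = e i" if "i \<in> S" for i
  proof -
    have "i < k"
      using S(1) that by auto
    then have "(take j r @ drop (Suc j) r) ! i = r ! skip i"
      using len j by (cases "i < j") (simp_all add: nth_append skip_def)
    also have "\<dots> = ?e (skip i)"
      using r(2) that by blast
    also have "\<dots> = e i"
      by (rule e_skip)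
    finally show ?thesis .
  qed
  moreover have "take j r @ drop (Suc j) r \<in># half_fraction j s D"
    using r(1) bspec[OF r(2), of j] by (auto simp: half_fraction_def)
  ultimately show "\<exists>r\<in>#half_fraction j s D. \<forall>i\<in>S. r ! i = e i"
    by blast
qed

section \<open>The Gray map\<close>

lemma Z4_cases: "(x::4) = 0 \<or> x = 1 \<or> x = 2 \<or> x = 3"
proof -
  have "card {0, 1, 2, 3 :: 4} = CARD(4)"
    by simp
  then have "{0, 1, 2, 3 :: 4} = UNIV"
    by (intro card_subset_eq) auto
  then show ?thesis
    by blast
qed

lemma length_gray [simp]: "length (gray x) = 2"
  by (simp add: gray_def)

lemma gray_add_2: "i < 2 \<Longrightarrow> gray (x + 2) ! i = - gray x ! i"
  using Z4_cases[of x] by (auto simp: gray_def less_2_cases_iff)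

lemma gray_surj:
  assumes "a \<in> {1, -1}" and "b \<in> {1, -1}"
  shows "\<exists>x. gray x = [a, b]"
proof -
  have "gray 0 = [1, 1]" "gray 1 = [1, -1]" "gray 2 = [-1, -1]" "gray 3 = [-1, 1]"
    by (auto simp: gray_def)
  then show ?thesis
    using assms by (metis insertE singletonD)
qed

text \<open>Neighbours on the cycle 0, 1, 2, 3 differ in one Gray level, and the two neighbours of
  \<open>x\<close> flip different levels. So some unit step touches only level
  \<open>b\<close>.\<close>

lemma gray_flip_bit:
  assumes "b < 2"
  shows "\<exists>d \<in> {1, 3}. \<forall>i < 2. i \<noteq> b \<longrightarrow> gray (x + d) ! i = gray x ! i"
  using assms Z4_cases[of x] by (auto simp: gray_def less_2_cases_iff)

section \<open>Solving one parity check modulo 4\<close>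

lemma ex_Z4_iff: "(\<exists>x::4. P x) \<longleftrightarrow> P 0 \<or> P 1 \<or> P 2 \<or> P 3"
  and all_Z4_iff: "(\<forall>x::4. P x) \<longleftrightarrow> P 0 \<and> P 1 \<and> P 2 \<and> P 3"
  using Z4_cases by metis+

text \<open>If \<open>p = q\<close>, both are units and 0, \<open>p\<close>, \<open>p + p\<close>
  are distinct; otherwise 0, \<open>p\<close>, \<open>q\<close> are. So at least three residues are
  attained.\<close>

lemma subset_sum_Z4_misses_one:
  fixes p q :: 4
  assumes "p \<noteq> 0" "q \<noteq> 0" "\<not> (p = 2 \<and> q = 2)"
  shows "\<exists>t. \<forall>x. x \<noteq> t \<longrightarrow> (\<exists>a\<in>{0, p}. \<exists>b\<in>{0, q}. a + b = x)"
  unfolding ex_Z4_iff all_Z4_iff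
  using Z4_cases[of p] Z4_cases[of q] assms by (elim disjE) simp_all

text \<open>The two choices of \<open>c\<close> leave two different targets for
  \<open>a + b\<close>, and at most one residue is unattainable.\<close>

lemma subset_sum_Z4:
  fixes p q r s :: 4
  assumes "p \<noteq> 0" "q \<noteq> 0" "r \<noteq> 0" "\<not> (p = 2 \<and> q = 2)"
  shows "\<exists>a\<in>{0, p}. \<exists>b\<in>{0, q}. \<exists>c\<in>{0, r}. s + a + b + c = 0"
proof -
  obtain t where t: "\<And>x. x \<noteq> t \<Longrightarrow> \<exists>a\<in>{0, p}. \<exists>b\<in>{0, q}. a + b = x"
    using subset_sum_Z4_misses_one[OF assms(1,2,4)] by blast
  have "\<exists>c\<in>{0, r}. - s - c \<noteq> t"
    using assms(3) by auto
  then obtain a b c where "a \<in> {0, p}" "b \<in> {0, q}" "c \<in> {0, r}" "a + b = - s - c"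
    using t by metis
  moreover from this have "s + a + b + c = 0"
    by (simp add: add.assoc)
  ultimately show ?thesis
    by blast
qed

text \<open>A unit \<open>p\<close> has all residues as multiples. If \<open>p = 2\<close>, the
  multiples are the even residues and \<open>q\<close> is odd, so \<open>b\<close> can correct the
  parity.\<close>

lemma multiple_plus_choice_Z4:
  fixes p q s :: 4
  assumes "p \<noteq> 0" "q \<noteq> 0" "\<not> (p = 2 \<and> q = 2)"
  shows "\<exists>x. \<exists>b\<in>{0, q}. s + p * x + b = 0"
  unfolding ex_Z4_iff using assms Z4_cases[of p] Z4_cases[of q] Z4_cases[of s] by auto

text \<open>Carries conditions on the coefficients of the check over to their products with unit
  steps.\<close>

lemma mult_unit_Z4:
  fixes p d :: 4
  assumes "d \<in> {1, 3}"
  shows "p * d = 0 \<longleftrightarrow> p = 0" and "p * d = 2 \<longleftrightarrow> p = 2"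
  using assms Z4_cases[of p] by auto

text \<open>Entry \<open>j\<close> carries the levels \<open>2 * j\<close> and
  \<open>2 * j + 1\<close>, and \<open>T\<close> leaves three levels free. An assignment with the
  prescribed levels is repaired by changing only entries with free levels; the cases are whether two
  free levels share an entry or not.\<close>

lemma parity_check_solution:
  fixes h :: "nat \<Rightarrow> 4" and e :: "nat \<Rightarrow> int"
  assumes nz: "\<And>j. j < m \<Longrightarrow> h j \<noteq> 0"
    and two: "\<And>i j. i < m \<Longrightarrow> j < m \<Longrightarrow> h i = 2 \<Longrightarrow> h j = 2 \<Longrightarrow> i = j"
    and T: "T \<subseteq> {..<2 * m}" "card T + 3 = 2 * m"
    and e: "\<forall>j\<in>T. e j \<in> {1, -1}"
  shows "\<exists>c. (\<Sum>j<m. h j * c j) = 0 \<and> (\<forall>j\<in>T. gray (c (j div 2)) ! (j mod 2) = e j)"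
proof -
  define e' where "e' j = (if j \<in> T then e j else 1)" for j
  have "\<exists>x. gray x = [e' (2 * j), e' (2 * j + 1)]" for j
    by (rule gray_surj) (use e in \<open>auto simp: e'_def\<close>)
  then obtain c0 where c0: "\<And>j. gray (c0 j) = [e' (2 * j), e' (2 * j + 1)]"
    by metis
  have base: "gray (c0 (j div 2)) ! (j mod 2) = e j" if "j \<in> T" for j
  proof -
    have "gray (c0 (j div 2)) ! (j mod 2) = e' (2 * (j div 2) + j mod 2)"
      by (cases "even j") (simp_all add: c0 odd_iff_mod_2_eq_one)
    then show ?thesis
      using that by (simp add: e'_def)
  qed
  \<comment> \<open>The defect of the initial assignment, which the repair must cancel.\<close>
  define s where "s = (\<Sum>j<m. h j * c0 j)"
  \<comment> \<open>\<open>d b\<close> will be a unit step on entry \<open>b div 2\<close> that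
    preserves the level other than \<open>b\<close>.\<close>
  have "\<forall>b. \<exists>d \<in> {1, 3::4}. \<forall>i < 2. i \<noteq> b mod 2 \<longrightarrow>
      gray (c0 (b div 2) + d) ! i = gray (c0 (b div 2)) ! i"
    by (intro allI gray_flip_bit) simp
  then obtain d :: "nat \<Rightarrow> 4" where d: "\<And>b. d b \<in> {1, 3}"
    and flip0: "\<And>b i. i < 2 \<Longrightarrow> i \<noteq> b mod 2 \<Longrightarrow>
      gray (c0 (b div 2) + d b) ! i = gray (c0 (b div 2)) ! i"
    by metis
  have flip: "gray (c0 (j div 2) + d b) ! (j mod 2) = gray (c0 (j div 2)) ! (j mod 2)"
    if "j div 2 = b div 2" "j \<noteq> b" for j b
  proof -
    have "j mod 2 \<noteq> b mod 2"
      using that by (metis div_mult_mod_eq)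
    then show ?thesis
      using flip0[of "j mod 2" b] that(1) by simp
  qed
  have "card ({..<2 * m} - T) = 3"
    using T by (simp add: card_Diff_subset finite_subset[OF T(1)])
  \<comment> \<open>Once the free levels are sorted, only consecutive ones need be compared for a
    common entry.\<close>
  then have len: "length (sorted_list_of_set ({..<2 * m} - T)) = Suc (Suc (Suc 0))"
    by simp
  then obtain x y z where l: "sorted_list_of_set ({..<2 * m} - T) = [x, y, z]"
    unfolding length_Suc_conv by auto
  have xyz: "{..<2 * m} - T = {x, y, z}" "x < y" "y < z"
    using set_sorted_list_of_set[of "{..<2 * m} - T"] strict_sorted_list_of_set[of "{..<2 * m} - T"]
    unfolding l by auto
  have "{x, y, z} \<subseteq> {..<2 * m} - T"
    by (simp only: xyz(1))
  then have lt: "x div 2 < m" "y div 2 < m" "z div 2 < m"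
    and nT: "x \<notin> T" "y \<notin> T" "z \<notin> T"
    by auto
  \<comment> \<open>Turns a chosen term of the check back into a change of the entry.\<close>
  have factor: "\<exists>t'\<in>{0, q}. t = p * t'" if "t \<in> {0, p * q}" for t p q :: 4
    using that by auto
  \<comment> \<open>Both levels of entry \<open>k\<close> are free, so it may change by any
    \<open>x\<close>; entry \<open>b div 2\<close> changes only by 0 or \<open>d b\<close>.\<close>
  have free_pair: ?thesis
    if kl: "k < m" "b div 2 < m" "k \<noteq> b div 2" and T': "\<forall>j\<in>T. j div 2 \<noteq> k" "b \<notin> T" for k b
  proof -
    let ?l = "b div 2"
    have "\<exists>x. \<exists>t\<in>{0, h ?l * d b}. s + h k * x + t = 0"
      by (rule multiple_plus_choice_Z4)
        (use two[OF kl(1,2)] kl in \<open>auto simp: mult_unit_Z4[OF d] nz\<close>)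
    then obtain x t where t: "t \<in> {0, h ?l * d b}" and eq: "s + h k * x + t = 0"
      by blast
    obtain t' where t': "t' \<in> {0, d b}" "t = h ?l * t'"
      using factor[OF t] by blast
    let ?c = "\<lambda>j. c0 j + (if j = k then x else 0) + (if j = ?l then t' else 0)"
    have "(\<Sum>j<m. h j * ?c j) = s + h k * x + h ?l * t'"
      using kl by (simp add: distrib_left sum.distrib s_def if_distrib[of "\<lambda>x. _ * x"] cong: if_cong)
    then have "(\<Sum>j<m. h j * ?c j) = 0"
      using eq t'(2) by simp
    moreover have "gray (?c (j div 2)) ! (j mod 2) = e j" if "j \<in> T" for j
      using t'(1) flip[of j b] that T' base[OF that] by (cases "j = b") auto
    ultimately show ?thesis
      by (intro exI[of _ ?c] conjI ballI)
  qed
  \<comment> \<open>An entry carries only two levels. So when two free levels share an entry, the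
    third lies elsewhere and no prescribed level is in the shared one.\<close>
  have pair: "j = a \<or> j = b" if "a < b" "a div 2 = b div 2" "j div 2 = a div 2" for a b j :: nat
    using that by (metis div_mult_mod_eq less_irrefl not_mod_2_eq_0_eq_1)
  consider "x div 2 = y div 2" | "y div 2 = z div 2"
    | "x div 2 \<noteq> y div 2" "y div 2 \<noteq> z div 2"
    by blast
  then show ?thesis
  proof cases
    case 1
    have eqs: "j = x \<or> j = y" if "j div 2 = x div 2" for j
      using pair[OF xyz(2) 1 that] .
    moreover have "x div 2 \<noteq> z div 2"
      using eqs[of z] xyz(2,3) by auto
    ultimately show ?thesis
      using free_pair[of "x div 2" z] lt nT by blast
  next
    case 2
    have eqs: "j = y \<or> j = z" if "j div 2 = y div 2" for j
      using pair[OF xyz(3) 2 that] .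
    moreover have "y div 2 \<noteq> x div 2"
      using eqs[of x] xyz(2,3) by auto
    ultimately show ?thesis
      using free_pair[of "y div 2" x] lt nT by blast
  next
    case 3
    moreover have "x div 2 \<le> y div 2" "y div 2 \<le> z div 2"
      using xyz(2,3) by (simp_all add: div_le_mono)
    ultimately have ne: "x div 2 \<noteq> y div 2" "y div 2 \<noteq> z div 2" "x div 2 \<noteq> z div 2"
      by simp_all
    let ?k = "x div 2" and ?l = "y div 2" and ?q = "z div 2"
    \<comment> \<open>The increments are nonzero because each step is a unit, and the first two are
      not both 2 because they belong to different entries.\<close>
    have "\<exists>a\<in>{0, h ?k * d x}. \<exists>b\<in>{0, h ?l * d y}. \<exists>g\<in>{0, h ?q * d z}. s + a + b + g = 0"
      by (rule subset_sum_Z4)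
        (use two[OF lt(1,2)] ne in \<open>auto simp: mult_unit_Z4[OF d] nz lt\<close>)
    then obtain a b g where abg: "a \<in> {0, h ?k * d x}" "b \<in> {0, h ?l * d y}" "g \<in> {0, h ?q * d z}"
      and eq: "s + a + b + g = 0"
      by blast
    obtain a' where a': "a' \<in> {0, d x}" "a = h ?k * a'"
      using factor[OF abg(1)] by blast
    obtain b' where b': "b' \<in> {0, d y}" "b = h ?l * b'"
      using factor[OF abg(2)] by blast
    obtain g' where g': "g' \<in> {0, d z}" "g = h ?q * g'"
      using factor[OF abg(3)] by blast
    let ?c = "\<lambda>j. c0 j + (if j = ?k then a' else 0) + (if j = ?l then b' else 0)
      + (if j = ?q then g' else 0)"
    have "(\<Sum>j<m. h j * ?c j) = s + h ?k * a' + h ?l * b' + h ?q * g'"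
      using lt by (simp add: distrib_left sum.distrib s_def if_distrib[of "\<lambda>x. _ * x"] cong: if_cong)
    then have "(\<Sum>j<m. h j * ?c j) = 0"
      using eq a'(2) b'(2) g'(2) by simp
    moreover have "gray (?c (j div 2)) ! (j mod 2) = e j" if "j \<in> T" for j
    proof -
      \<comment> \<open>A prescribed level in the entry of a free level \<open>b\<close> is the
        other level there, which changing by 0 or \<open>d b\<close> preserves.\<close>
      have keep: "gray (c0 (j div 2) + t) ! (j mod 2) = e j"
        if "b \<notin> T" "j div 2 = b div 2" "t \<in> {0, d b}" for b t
        using flip[of j b] that \<open>j \<in> T\<close> base[of j] by (cases "j = b") auto
      consider "j div 2 = ?k" | "j div 2 = ?l" | "j div 2 = ?q"
        | "j div 2 \<noteq> ?k" "j div 2 \<noteq> ?l" "j div 2 \<noteq> ?q"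
        by blast
      then show ?thesis
      proof cases
        case 1
        then show ?thesis
          using keep[OF nT(1) 1 a'(1)] ne by simp
      next
        case 2
        then show ?thesis
          using keep[OF nT(2) 2 b'(1)] ne by simp
      next
        case 3
        then show ?thesis
          using keep[OF nT(3) 3 g'(1)] ne by simp
      next
        case 4
        then show ?thesis
          using base[OF that] by simp
      qed
    qed
    ultimately show ?thesis
      by (intro exI[of _ ?c] conjI ballI)
  qed
qed

section \<open>Designs generated by \<open>(v, I\<^sub>n)\<close>\<close>

lemma concat_pairs_nth:
  assumes "\<And>x. length (f x) = 2"
  shows "i < 2 * length xs \<Longrightarrow> concat (map f xs) ! i = f (xs ! (i div 2)) ! (i mod 2)"
proof (induction xs arbitrary: i)
  case (Cons x xs)
  show ?case
  proof (cases "i < 2")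
    case True
    then show ?thesis
      using assms by (simp add: nth_append)
  next
    case False
    then obtain k where k: "i = k + 2"
      by (metis add.commute le_Suc_ex not_less)
    then show ?thesis
      using Cons.IH[of k] Cons.prems assms by (simp add: nth_append)
  qed
qed simp

definition run :: "4 mat \<Rightarrow> 4 vec \<Rightarrow> int list" where
  "run G u = concat (map gray (list_of_vec (transpose_mat G *\<^sub>v u)))"

lemma length_concat_gray: "length (concat (map gray xs)) = 2 * length xs"
  by (induction xs) auto

lemma length_run: "length (run G u) = 2 * dim_col G"
  by (simp add: run_def length_concat_gray)

lemma run_nth:
  "i < 2 * dim_col G \<Longrightarrow>
    run G u ! i = gray ((transpose_mat G *\<^sub>v u) $ (i div 2)) ! (i mod 2)"
  unfolding run_def by (subst concat_pairs_nth) (auto simp: list_of_vec_index)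

lemma set_run: "set (run G u) \<subseteq> {1, -1}"
  by (auto simp: run_def gray_def split: if_splits)

lemma generated_design_run:
  "generated_design G = image_mset (run G) (mset_set (carrier_vec (dim_row G)))"
  by (simp add: generated_design_def run_def[abs_def])

lemma in_generated_design_iff:
  "r \<in># generated_design G \<longleftrightarrow> (\<exists>u \<in> carrier_vec (dim_row G). r = run G u)"
  by (auto simp: generated_design_run finite_carrier_vec_4)

lemma card_carrier_vec_4: "card (carrier_vec n :: 4 vec set) = 2 ^ (2 * n)"
proof -
  have "bij_betw list_of_vec (carrier_vec n :: 4 vec set) {xs. set xs \<subseteq> UNIV \<and> length xs = n}"
    by (rule bij_betw_byWitness[where f' = vec_of_list])
      (auto simp: vec_list list_vec intro: carrier_vecI)
  then have "card (carrier_vec n :: 4 vec set) = CARD(4) ^ n"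
    using card_lists_length_eq[of "UNIV :: 4 set" n] by (simp add: bij_betw_same_card)
  then show ?thesis
    by (simp add: power_mult)
qed

text \<open>Translation by \<open>w\<close> adds \<open>2\<close> to the entry behind factor \<open>j\<close>, so it exchanges the two half-fractions.\<close>

lemma size_balanced_factor:
  assumes j: "j < 2 * dim_col G" and w: "w \<in> carrier_vec (dim_row G)"
    and w2: "(transpose_mat G *\<^sub>v w) $ (j div 2) = 2" and s: "s \<in> {1, -1}"
  shows "2 * size {# r \<in># generated_design G. r ! j = s #} = 2 ^ (2 * dim_row G)"
proof -
  let ?A = "\<lambda>s. {u \<in> carrier_vec (dim_row G). run G u ! j = s}"
  have fin: "finite (?A s)" for s
    by (rule finite_subset[OF _ finite_carrier_vec_4[of "dim_row G"]]) auto
  have neg: "run G (u + w) ! j = - run G u ! j" if "u \<in> carrier_vec (dim_row G)" for u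
  proof -
    have "transpose_mat G *\<^sub>v (u + w) = transpose_mat G *\<^sub>v u + transpose_mat G *\<^sub>v w"
      by (rule mult_add_distrib_mat_vec[of _ "dim_col G" "dim_row G"]) (use that w in auto)
    then show ?thesis
      using j w2 by (auto simp: run_nth gray_add_2)
  qed
  have inj: "inj_on (\<lambda>u. u + w) (?A s)" for s
  proof (rule inj_onI)
    fix u u'
    assume "u \<in> ?A s" "u' \<in> ?A s" and eq: "u + w = u' + w"
    then have u: "u \<in> carrier_vec (dim_row G)" "u' \<in> carrier_vec (dim_row G)"
      by auto
    show "u = u'"
    proof (rule eq_vecI)
      fix i
      assume "i < dim_vec u'"
      then show "u $ i = u' $ i"
        using arg_cong[OF eq, of "\<lambda>x. x $ i"] u w by auto
    qed (use u in auto)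
  qed
  \<comment> \<open>Used for \<open>s\<close> and for \<open>- s\<close>, this gives
    equality.\<close>
  have le: "card (?A s) \<le> card (?A (- s))" for s
    by (rule card_inj_on_le[OF inj _ fin]) (use w neg in auto)
  have "card (?A s) = card (?A (- s))"
    using le[of s] le[of "- s"] by simp
  moreover have "carrier_vec (dim_row G) = ?A s \<union> ?A (- s)"
  proof -
    have "run G u ! j = s \<or> run G u ! j = - s" for u
      using subsetD[OF set_run nth_mem, of j G u] j s by (auto simp: length_run)
    then show ?thesis
      by auto
  qed
  then have "2 ^ (2 * dim_row G) = card (?A s \<union> ?A (- s))"
    using card_carrier_vec_4 by metis
  moreover have "card (?A s \<union> ?A (- s)) = card (?A s) + card (?A (- s))"
    by (rule card_Un_disjoint) (use fin s in auto)
  moreover have "size {# r \<in># generated_design G. r ! j = s #} = card (?A s)"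
    by (simp add: generated_design_run filter_mset_image_mset finite_carrier_vec_4)
  ultimately show ?thesis
    by simp
qed

section \<open>The code generated by \<open>(v, I_n)\<close>: half-fraction sizes and
  projectivity\<close>

lemma dim_generator [simp]:
  "dim_row (generator v) = dim_vec v" "dim_col (generator v) = Suc (dim_vec v)"
  by (auto simp: generator_def)

lemma generator_mult_0:
  assumes "v \<in> carrier_vec n" and "u \<in> carrier_vec n"
  shows "(transpose_mat (generator v) *\<^sub>v u) $ 0 = (\<Sum>i<n. v $ i * u $ i)"
  using assms by (auto simp: generator_def scalar_prod_def atLeast0LessThan intro!: sum.cong)

lemma generator_mult_Suc:
  assumes "v \<in> carrier_vec n" and "u \<in> carrier_vec n" and "i < n"
  shows "(transpose_mat (generator v) *\<^sub>v u) $ Suc i = u $ i"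
proof -
  have "(transpose_mat (generator v) *\<^sub>v u) $ Suc i = (\<Sum>k<n. if k = i then u $ k else 0)"
    using assms by (auto simp: generator_def scalar_prod_def atLeast0LessThan
        if_distrib[of "\<lambda>x. x * _"] cong: if_cong)
  then show ?thesis
    using assms(3) by simp
qed

lemma two_level_generated_design:
  "v \<in> carrier_vec n \<Longrightarrow>
    two_level_design (2 ^ (2 * n)) (2 * n + 2) (generated_design (generator v))"
  unfolding two_level_design_def Ball_def in_generated_design_iff
  using set_run
  by (auto simp: length_run generated_design_run card_carrier_vec_4)

lemma generator_shift_by_2:
  assumes v: "v \<in> carrier_vec n" and unit: "i0 < n" "v $ i0 \<in> {1, 3}" and k: "k < Suc n"
  shows "\<exists>w \<in> carrier_vec n. (transpose_mat (generator v) *\<^sub>v w) $ k = 2"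
proof (cases k)
  case 0
  \<comment> \<open>Twice either unit is 2, so doubling the unit vector at \<open>i0\<close> puts 2
    into entry 0.\<close>
  have "(\<Sum>i<n. v $ i * (2 \<cdot>\<^sub>v unit_vec n i0) $ i) = (\<Sum>i<n. if i = i0 then 2 * v $ i else 0)"
    by (rule sum.cong) (auto simp: unit_vec_def)
  also have "\<dots> = 2"
    using unit by auto
  finally show ?thesis
    using 0 generator_mult_0[OF v, of "2 \<cdot>\<^sub>v unit_vec n i0"] by (intro bexI) auto
next
  case (Suc i)
  then show ?thesis
    using k generator_mult_Suc[OF v, of "2 \<cdot>\<^sub>v unit_vec n i" i] by (intro bexI) auto
qed

text \<open>The branching factor is balanced, hence exactly half of the runs remain; a unit in
  \<open>v\<close> supplies the required translation when the factor comes from column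
  \<open>v\<close>.\<close>

lemma two_level_half_fraction:
  assumes v: "v \<in> carrier_vec n" and unit: "i0 < n" "v $ i0 \<in> {1, 3}"
    and j: "j < 2 * n + 2" and s: "s \<in> {1, -1}"
  shows "two_level_design (2 ^ (2 * n - 1)) (2 * n + 1)
    (half_fraction j s (generated_design (generator v)))"
proof -
  let ?D = "generated_design (generator v)"
  obtain w where w: "w \<in> carrier_vec n" "(transpose_mat (generator v) *\<^sub>v w) $ (j div 2) = 2"
    using generator_shift_by_2[OF v unit, of "j div 2"] j by (auto simp: less_mult_imp_div_less)
  have "2 * size {# r \<in># ?D. r ! j = s #} = 2 ^ (2 * n)"
    using size_balanced_factor[of j "generator v" w s] v j w s by simp
  moreover have "(2::nat) ^ (2 * n) = 2 * 2 ^ (2 * n - 1)"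
    using unit(1) by (simp flip: power_Suc)
  ultimately have "size (half_fraction j s ?D) = 2 ^ (2 * n - 1)"
    by (simp add: half_fraction_def)
  moreover have "length r = 2 * n + 1 \<and> set r \<subseteq> {1, -1}" if "r \<in># half_fraction j s ?D" for r
  proof -
    obtain r' where r': "r' \<in># ?D" "r = take j r' @ drop (Suc j) r'"
      using \<open>r \<in># half_fraction j s ?D\<close> by (auto simp: half_fraction_def)
    then have "length r' = 2 * n + 2" "set r' \<subseteq> {1, -1}"
      using two_level_generated_design[OF v] by (auto simp: two_level_design_def)
    then show ?thesis
      using j r'(2) set_take_subset[of j r'] set_drop_subset[of "Suc j" r'] by auto
  qed
  ultimately show ?thesis
    by (simp add: two_level_design_def)
qed

lemma generated_design_has_projectivity:
  assumes v: "v \<in> carrier_vec n" and n: "n \<ge> 1"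
    and nz: "\<And>i. i < n \<Longrightarrow> v $ i \<noteq> 0"
    and two: "\<And>i j. i < n \<Longrightarrow> j < n \<Longrightarrow> v $ i = 2 \<Longrightarrow> v $ j = 2 \<Longrightarrow> i = j"
  shows "has_projectivity (2 * n + 2) (generated_design (generator v)) (2 * n - 1)"
  unfolding has_projectivity_def
proof (intro conjI allI impI)
  show "2 * n - 1 \<le> 2 * n + 2"
    by simp
next
  fix T and e :: "nat \<Rightarrow> int"
  assume T: "T \<subseteq> {..<2 * n + 2}" "card T = 2 * n - 1" and e: "\<forall>j\<in>T. e j \<in> {1, -1}"
  \<comment> \<open>The coefficient -1 of entry 0 is neither 0 nor 2, so the conditions on
    \<open>v\<close> pass to \<open>h\<close>. With \<open>n + 1\<close> entries,
    \<open>2 * n - 1\<close> prescribed levels leave three free.\<close>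
  define h :: "nat \<Rightarrow> 4" where "h j = (case j of 0 \<Rightarrow> -1 | Suc i \<Rightarrow> v $ i)" for j
  have "\<exists>c. (\<Sum>j<Suc n. h j * c j) = 0 \<and> (\<forall>j\<in>T. gray (c (j div 2)) ! (j mod 2) = e j)"
  proof (rule parity_check_solution)
    show "h j \<noteq> 0" if "j < Suc n" for j
      using that nz by (auto simp: h_def split: nat.split)
    show "i = j" if "i < Suc n" "j < Suc n" "h i = 2" "h j = 2" for i j
      using that two by (auto simp: h_def split: nat.splits)
  qed (use T e n in auto)
  then obtain c where c: "(\<Sum>j<Suc n. h j * c j) = 0"
    "\<And>j. j \<in> T \<Longrightarrow> gray (c (j div 2)) ! (j mod 2) = e j"
    by blast
  \<comment> \<open>\<open>u\<close> drops entry 0, which the check recovers.\<close>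
  define u where "u = vec n (\<lambda>i. c (Suc i))"
  have u: "u \<in> carrier_vec n"
    by (simp add: u_def)
  have "c 0 = (\<Sum>i<n. v $ i * u $ i)"
    using c(1) by (simp add: sum.lessThan_Suc_shift h_def u_def del: sum.lessThan_Suc)
  then have row: "(transpose_mat (generator v) *\<^sub>v u) $ k = c k" if "k < Suc n" for k
    using that generator_mult_0[OF v u] generator_mult_Suc[OF v u] by (cases k) (auto simp: u_def)
  have "run (generator v) u ! j = e j" if "j \<in> T" for j
  proof -
    have "j < 2 * Suc n"
      using that T(1) by auto
    then show ?thesis
      using run_nth[of j "generator v" u] row[of "j div 2"] c(2)[OF that] v by auto
  qed
  then show "\<exists>r\<in>#generated_design (generator v). \<forall>j\<in>T. r ! j = e j"
    using u v by (intro bexI[of _ "run (generator v) u"]) (auto simp: in_generated_design_iff)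
qed

text \<open>In either case the frequencies of 1, 2 and 3 add up to \<open>n\<close>, leaving no
  index for 0. Units occur at least \<open>n - 1\<close> times, which is positive as
  \<open>n \<ge> 2\<close>.\<close>

lemma freq_conditions:
  assumes n: "n \<ge> 2" and v: "v \<in> carrier_vec n"
    and f: "(freq 1 v + freq 3 v = n - 1 \<and> freq 2 v = 1) \<or>
      (freq 1 v + freq 3 v = n \<and> freq 2 v = 0)"
  shows "\<And>i. i < n \<Longrightarrow> v $ i \<noteq> 0"
    and "\<And>i j. i < n \<Longrightarrow> j < n \<Longrightarrow> v $ i = 2 \<Longrightarrow> v $ j = 2 \<Longrightarrow> i = j"
    and "\<exists>i<n. v $ i \<in> {1, 3}"
proof -
  let ?F = "\<lambda>a. {i. i < n \<and> v $ i = a}"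
  have freq: "freq a v = card (?F a)" for a
    using v by (simp add: freq_def)
  have "card (?F 1 \<union> ?F 3 \<union> ?F 2) = freq 1 v + freq 3 v + freq 2 v"
    unfolding freq by (subst card_Un_disjoint; (subst card_Un_disjoint)?) auto
  also have "\<dots> = card {..<n}"
    using f n by auto
  finally have "?F 1 \<union> ?F 3 \<union> ?F 2 = {..<n}"
    by (intro card_subset_eq) auto
  then have "i \<in> ?F 1 \<union> ?F 3 \<union> ?F 2" if "i < n" for i
    using that by simp
  then show "v $ i \<noteq> 0" if "i < n" for i
    using that by fastforce
  have "card (?F 2) \<le> Suc 0"
    using f unfolding freq by linarith
  then show "i = j" if "i < n" "j < n" "v $ i = 2" "v $ j = 2" for i j
    using that card_le_Suc0_iff_eq[of "?F 2"] by auto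
  show "\<exists>i<n. v $ i \<in> {1, 3}"
  proof (rule ccontr)
    assume "\<not> ?thesis"
    then have "?F 1 = {}" "?F 3 = {}"
      by auto
    then have "freq 1 v = 0" "freq 3 v = 0"
      unfolding freq by (simp_all only: card.empty)
    then show False
      using f n by linarith
  qed
qed

theorem theorem9:
  fixes n :: nat and v :: "4 vec" and D H :: design
  assumes "n \<ge> 2"
    and "v \<in> carrier_vec n"
    and "(freq 1 v + freq 3 v = n - 1 \<and> freq 2 v = 1) \<or>
         (freq 1 v + freq 3 v = n \<and> freq 2 v = 0)"
    and "D = generated_design (generator v)"
    and "H \<in> half_fractions (2 * n + 2) D"
  shows "has_max_projectivity_among (2 * n + 1) H (2 * n - 2) (half_fraction_class n)"
proof -
  note f = freq_conditions[OF assms(1-3)]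
  obtain j s where js: "j < 2 * n + 2" "s \<in> {1, -1}" "H = half_fraction j s D"
    using assms(5) by (auto simp: half_fractions_def)
  have upper: "projectivity (2 * n + 1) E \<le> 2 * n - 2" if "E \<in> half_fraction_class n" for E
  proof (rule projectivity_le)
    have E: "two_level_design (2 ^ (2 * n - 1)) (2 * n + 1) E"
      using that by (simp add: half_fraction_class_def)
    then show "E \<noteq> {#}"
      by (auto simp: two_level_design_def)
    \<comment> \<open>\<open>n \<ge> 2\<close> is essential here: for \<open>n = 1\<close> and
      \<open>w = (2)\<close>, branching on factor 2 at level 1 leaves the runs
      \<open>[1, 1, 1]\<close> and \<open>[-1, -1, -1]\<close>, of projectivity 1.\<close>
    have "2 * n + 1 = 2 * n - 1 + 2" "Suc (2 * n - 2) = 2 * n - 1" "2 * n - 1 \<ge> 2"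
      using assms(1) by auto
    then show "\<not> has_projectivity (2 * n + 1) E (Suc (2 * n - 2))"
      using index_unity_not_has_projectivity[of "2 * n - 1" E] E by simp
  qed
  have "two_level_design (2 ^ (2 * n - 1)) (2 * n + 1) H"
    using f(3) two_level_half_fraction[OF assms(2)] js assms(4) by blast
  then have H: "H \<in> half_fraction_class n"
    using assms(2,4,5) by (auto simp: half_fraction_class_def)
  \<comment> \<open>The branching level uses up one of these \<open>2 * n - 1\<close>
    levels.\<close>
  have "has_projectivity (2 * n + 2) D (2 * n - 1)"
    using generated_design_has_projectivity[OF assms(2)] f(1,2) assms(1,4) by simp
  moreover have "2 * n + 2 = Suc (2 * n + 1)" "2 * n - 1 = Suc (2 * n - 2)"
    using assms(1) by auto
  ultimately have "has_projectivity (2 * n + 1) H (2 * n - 2)"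
    using has_projectivity_half_fraction[of "2 * n + 1" D "2 * n - 2" "2 ^ (2 * n)" j s]
      two_level_generated_design[OF assms(2)] js assms(4) by simp
  then show ?thesis
    using projectivity_ge upper H by (simp add: has_max_projectivity_among_def le_antisym)
qed

end
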